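(* Let $G$ be a finite, simple, connected graph and let $D\subseteq V(G)$ be a connected two-way dominating set of $G$. Then $$pc(G)\leq pc(G[D])+2.$$
   Context: A dominating set of $G$ is a set $D\subseteq V(G)$ such that every vertex not in $D$ is adjacent to some vertex of $D$. A dominating set $D$ is a two-way dominating set if every pendant vertex (vertex of degree 1) of $G$ lies in $D$; it is a connected two-way dominating set if moreover the induced subgraph $G[D]$ is connected. For an edge-colored graph, a path is a proper path if no two consecutive edges of the path receive the same color. An edge-coloring of a connected graph $G$ is a proper-path coloring if every pair of distinct vertices $u,v$ is joined by a proper $u$-$v$ path. The proper connection number $pc(G)$ is the minimum number of colors in a proper-path coloring of $G$.
   Formalization: The proper connection number of a one-vertex graph is taken to be 1 (palettes are nonempty); with value 0 the claim fails for three triangles sharing a vertex v and D = {v}, where pc(G) = 3. *)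

theory Defs
  imports "Graph_Theory.Digraph_Component"
begin

text \<open>
  A finite simple graph is a \<^locale>\<open>graph\<close>, i.e. a finite, loop-free, symmetric digraph without
  parallel arcs: an undirected edge is a pair of opposite arcs. Edge colorings are functions on
  the unordered pairs of endpoints, so that opposite arcs get the same color.
\<close>

definition edge_of :: "('a, 'b) pre_digraph \<Rightarrow> 'b \<Rightarrow> 'a set" where
  "edge_of G a = {tail G a, head G a}"

definition edges :: "('a, 'b) pre_digraph \<Rightarrow> 'a set set" where
  "edges G = edge_of G ` arcs G"

definition dominating_set :: "('a, 'b) pre_digraph \<Rightarrow> 'a set \<Rightarrow> bool" where
  "dominating_set G D \<longleftrightarrow>
     D \<subseteq> verts G \<and> (\<forall>v \<in> verts G - D. \<exists>u \<in> D. v \<rightarrow>\<^bsub>G\<^esub> u)"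

text \<open>In a symmetric digraph the out-degree is the degree of the undirected graph.\<close>

definition pendant :: "('a, 'b) pre_digraph \<Rightarrow> 'a \<Rightarrow> bool" where
  "pendant G v \<longleftrightarrow> v \<in> verts G \<and> out_degree G v = 1"

definition two_way_dominating_set :: "('a, 'b) pre_digraph \<Rightarrow> 'a set \<Rightarrow> bool" where
  "two_way_dominating_set G D \<longleftrightarrow> dominating_set G D \<and> (\<forall>v. pendant G v \<longrightarrow> v \<in> D)"

definition connected_two_way_dominating_set :: "('a, 'b) pre_digraph \<Rightarrow> 'a set \<Rightarrow> bool" where
  "connected_two_way_dominating_set G D \<longleftrightarrow>
     two_way_dominating_set G D \<and> connected (G \<restriction> D)"

definition proper_path ::
    "('a, 'b) pre_digraph \<Rightarrow> ('a set \<Rightarrow> nat) \<Rightarrow> 'a \<Rightarrow> 'b list \<Rightarrow> 'a \<Rightarrow> bool" where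
  "proper_path G c u p v \<longleftrightarrow>
     pre_digraph.apath G u p v \<and> successively (\<lambda>a b. c (edge_of G a) \<noteq> c (edge_of G b)) p"

definition proper_path_coloring :: "('a, 'b) pre_digraph \<Rightarrow> ('a set \<Rightarrow> nat) \<Rightarrow> bool" where
  "proper_path_coloring G c \<longleftrightarrow>
     (\<forall>u \<in> verts G. \<forall>v \<in> verts G. u \<noteq> v \<longrightarrow> (\<exists>p. proper_path G c u p v))"

text \<open>
  Colorings take values in a nonempty palette \<open>{1..k}\<close>. The condition \<open>1 \<le> k\<close> matters only for
  the one-vertex graph, which has no edges: it gives it the value 1, in line with the usual
  convention that \<open>pc\<close> equals 1 exactly for the complete graphs.
\<close>

definition pc :: "('a, 'b) pre_digraph \<Rightarrow> nat" where
  "pc G = (LEAST k. 1 \<le> k \<and> (\<exists>c. c ` edges G \<subseteq> {1..k} \<and> proper_path_coloring G c))"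

end

theory Submission
  imports Defs
begin

text \<open>
  Color \<open>G[D]\<close> optimally with \<open>{1..k}\<close>. Let \<open>X\<close> be a maximal independent set of \<open>G - D\<close> and choose
  for every vertex \<open>v\<close> outside \<open>D\<close> a neighbor \<open>f v\<close> in \<open>D\<close>. The edges \<open>{v, f v}\<close> with \<open>v\<close> in \<open>X\<close> get
  color \<open>k + 1\<close>, all other edges between \<open>D\<close> and its complement get color \<open>k + 2\<close>, and the edges
  of \<open>G - D\<close> get color 1. Two vertices \<open>u\<close>, \<open>z\<close> outside \<open>D\<close> are joined through \<open>f u\<close>, a proper path in
  \<open>G[D]\<close>, and \<open>f z\<close>, unless \<open>{u, f u}\<close> and \<open>{z, f z}\<close> have the same color. In that case \<open>u\<close> reaches \<open>D\<close>
  with the other new color instead: if \<open>u\<close> has a neighbor \<open>x\<close> on the other side of the partition of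
  \<open>G - D\<close> into \<open>X\<close> and its complement, then through \<open>x\<close> and \<open>f x\<close>; otherwise \<open>u\<close> lies in \<open>X\<close> and all
  its neighbors lie in \<open>D\<close>, and since \<open>u\<close> is not pendant, one of them differs from \<open>f u\<close>.
\<close>

text \<open>By induction on \<open>W\<close>: a maximal independent set stays maximal when a new
  \<open>w\<close> has a neighbor in it; otherwise \<open>w\<close> joins it.\<close>

lemma finite_maximal_independent_set:
  assumes "finite W" and "symp_on W R" and "irreflp_on W R"
  obtains X where "X \<subseteq> W" and "\<forall>x\<in>X. \<forall>y\<in>X. \<not> R x y" and "\<forall>y\<in>W - X. \<exists>x\<in>X. R y x"
proof -
  from assms
  have "\<exists>X\<subseteq>W. (\<forall>x\<in>X. \<forall>y\<in>X. \<not> R x y) \<and> (\<forall>y\<in>W - X. \<exists>x\<in>X. R y x)"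
  proof (induction W rule: finite_induct)
    case empty
    show ?case by simp
  next
    case (insert w W)
    have "symp_on W R" "irreflp_on W R"
      using insert.prems by (auto simp: symp_on_def irreflp_on_def)
    with insert.IH obtain X where X: "X \<subseteq> W" "\<forall>x\<in>X. \<forall>y\<in>X. \<not> R x y" "\<forall>y\<in>W - X. \<exists>x\<in>X. R y x"
      by blast
    show ?case
    proof (cases "\<exists>x\<in>X. R w x")
      case True
      with X show ?thesis by (intro exI[of _ X]) auto
    next
      case False
      moreover have "\<not> R w w" "\<And>x. x \<in> X \<Longrightarrow> R x w \<Longrightarrow> R w x"
        using insert.prems X(1) by (auto simp: symp_on_def irreflp_on_def)
      ultimately show ?thesis using X by (intro exI[of _ "insert w X"]) auto
    qed
  qed
  then show thesis using that by blast
qed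

lemma (in wf_digraph) proper_path_Cons:
  assumes "proper_path G c w p v" and "e \<in> arcs G" "tail G e = u" "head G e = w"
    and "u \<notin> set (awalk_verts w p)"
    and "p \<noteq> [] \<Longrightarrow> c (edge_of G e) \<noteq> c (edge_of G (hd p))"
  shows "proper_path G c u (e # p) v"
  using assms by (auto simp: proper_path_def apath_Cons_iff successively_Cons)

lemma (in wf_digraph) proper_path_snoc:
  assumes "proper_path G c u p w" and "e \<in> arcs G" "tail G e = w" "head G e = v"
    and "v \<notin> set (awalk_verts u p)"
    and "p \<noteq> [] \<Longrightarrow> c (edge_of G (last p)) \<noteq> c (edge_of G e)"
  shows "proper_path G c u (p @ [e]) v"
proof -
  have "apath u p w" using assms(1) by (simp add: proper_path_def)
  then have "awlast u p = w" by (auto simp: apath_def)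
  moreover have "w \<noteq> v" using assms(5) \<open>apath u p w\<close> by (auto simp: apath_def)
  ultimately show ?thesis
    using assms by (auto simp: proper_path_def apath_append_iff apath_simps successively_append_iff)
qed

text \<open>A path never returns to the tail of an arc, so that tail is not an endpoint of the next
  arc. Hence any injective coloring makes every path proper.\<close>

lemma (in wf_digraph) apath_successively_edge_of_neq:
  assumes "apath u p v"
  shows "successively (\<lambda>a b. edge_of G a \<noteq> edge_of G b) p"
  using assms
proof (induction p arbitrary: u)
  case (Cons e p)
  show ?case
  proof (cases p)
    case (Cons e' p')
    with Cons.prems have "tail G e \<noteq> tail G e'" "tail G e \<noteq> head G e'"
      by (cases p'; auto simp: apath_Cons_iff)+
    then have "edge_of G e \<noteq> edge_of G e'" by (auto simp: edge_of_def)
    moreover have "successively (\<lambda>a b. edge_of G a \<noteq> edge_of G b) p"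
      using Cons.IH Cons.prems by (auto simp: apath_Cons_iff)
    ultimately show ?thesis using Cons by simp
  qed simp
qed simp

text \<open>The minimum in \<open>pc\<close> is attained, since an injective coloring of the
  finitely many edges is a candidate.\<close>

lemma (in graph) proper_path_coloring_pc:
  assumes "connected G"
  obtains c where "1 \<le> pc G" and "c ` edges G \<subseteq> {1..pc G}" and "proper_path_coloring G c"
proof -
  have "finite (edges G)" by (simp add: edges_def)
  then obtain f :: "'a set \<Rightarrow> nat" and n where f: "f ` edges G = {i. i < n}" "inj_on f (edges G)"
    using finite_imp_inj_to_nat_seg by metis
  have "strongly_connected G"
    using assms sym_arcs by (simp add: symmetric_connected_imp_strongly_connected)
  have "\<exists>p. proper_path G (Suc \<circ> f) u p v" if uv: "u \<in> verts G" "v \<in> verts G" for u v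
  proof -
    obtain p where p: "apath u p v"
      using uv \<open>strongly_connected G\<close> reachable_apath by (metis strongly_connectedE)
    then have "set p \<subseteq> arcs G" by (auto simp: apath_def awalk_def)
    then have "successively (\<lambda>a b. (Suc \<circ> f) (edge_of G a) \<noteq> (Suc \<circ> f) (edge_of G b)) p"
      by (intro successively_mono[OF apath_successively_edge_of_neq[OF p]])
        (use f(2) in \<open>auto simp: edges_def inj_on_eq_iff subset_iff\<close>)
    with p show ?thesis by (auto simp: proper_path_def)
  qed
  then have "proper_path_coloring G (Suc \<circ> f)" by (simp add: proper_path_coloring_def)
  moreover have "(Suc \<circ> f) ` edges G \<subseteq> {1..Suc n}"
  proof -
    have "f e < n" if "e \<in> edges G" for e using f(1) that by blast
    then show ?thesis by fastforce
  qed
  ultimately have "1 \<le> Suc n \<and> (\<exists>c. c ` edges G \<subseteq> {1..Suc n} \<and> proper_path_coloring G c)"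
    by (intro conjI exI[of _ "Suc \<circ> f"]) auto
  from LeastI[of "\<lambda>k. 1 \<le> k \<and> (\<exists>c. c ` edges G \<subseteq> {1..k} \<and> proper_path_coloring G c)", OF this]
  show thesis using that by (auto simp: pc_def)
qed

lemma pc_le:
  assumes "1 \<le> k" and "c ` edges G \<subseteq> {1..k}" and "proper_path_coloring G c"
  shows "pc G \<le> k"
  unfolding pc_def using assms by (intro Least_le) blast

text \<open>A second arc leaves \<open>v\<close>, and without parallel arcs its head differs from
  \<open>w\<close>.\<close>

lemma (in graph) non_pendant_other_neighbor:
  assumes "v \<rightarrow> w" and "\<not> pendant G v"
  obtains x where "v \<rightarrow> x" and "x \<noteq> w"
proof -
  obtain e where e: "e \<in> arcs G" "tail G e = v" "head G e = w"
    using assms(1) by (auto simp: arcs_ends_conv)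
  have "out_arcs G v \<noteq> {e}"
    using assms e by (auto simp: pendant_def out_degree_def)
  with e obtain e' where e': "e' \<in> arcs G" "tail G e' = v" "e' \<noteq> e"
    by (auto simp: out_arcs_def)
  then have "head G e' \<noteq> w"
    using e no_multi_arcs[of e e'] by (auto simp: arc_to_ends_def)
  with e' show thesis using that by (auto simp: arcs_ends_conv)
qed

theorem theorem4p1:
  fixes G :: "('a, 'b) pre_digraph" and D :: "'a set"
  assumes "graph G" and "connected G"
    and "connected_two_way_dominating_set G D"
  shows "pc G \<le> pc (G \<restriction> D) + 2"
proof -
  interpret graph G by fact
  have DV: "D \<subseteq> verts G" and dom: "\<forall>v \<in> verts G - D. \<exists>u \<in> D. v \<rightarrow>\<^bsub>G\<^esub> u"
    and pend: "\<And>v. pendant G v \<Longrightarrow> v \<in> D" and conD: "connected (G \<restriction> D)"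
    using assms(3)
    by (auto simp: connected_two_way_dominating_set_def two_way_dominating_set_def
        dominating_set_def)
  have ind: "induced_subgraph (G \<restriction> D) G" using DV by (rule induced_induce)
  have "graph (G \<restriction> D)"
    using digraphI_induced[OF ind] induced_graph_imp_symmetric[OF sym_arcs ind]
    by (rule digraph.graphI)
  then interpret H: graph "G \<restriction> D" .
  define k where "k = pc (G \<restriction> D)"
  obtain c where k1: "1 \<le> k" and c: "c ` edges (G \<restriction> D) \<subseteq> {1..k}"
    and cp: "proper_path_coloring (G \<restriction> D) c"
    using H.proper_path_coloring_pc[OF conD] unfolding k_def by blast
  obtain f where f: "\<And>v. v \<in> verts G - D \<Longrightarrow> f v \<in> D \<and> v \<rightarrow>\<^bsub>G\<^esub> f v"
    using dom by metis
  have adj_sym: "u \<rightarrow>\<^bsub>G\<^esub> v \<Longrightarrow> v \<rightarrow>\<^bsub>G\<^esub> u" for u v using sym_arcs by (rule arcs_ends_symmetric)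
  have adj_irrefl: "\<not> u \<rightarrow>\<^bsub>G\<^esub> u" for u by (auto simp: arcs_ends_conv dest: no_loops)
  obtain X where X: "X \<subseteq> verts G - D" "\<forall>x\<in>X. \<forall>y\<in>X. \<not> x \<rightarrow>\<^bsub>G\<^esub> y"
    "\<forall>y\<in>verts G - D - X. \<exists>x\<in>X. y \<rightarrow>\<^bsub>G\<^esub> x"
    by (rule finite_maximal_independent_set[of "verts G - D" "\<lambda>x y. x \<rightarrow>\<^bsub>G\<^esub> y"])
      (auto simp: symp_on_def irreflp_on_def adj_irrefl intro: adj_sym)
  \<comment> \<open>Edges of \<open>G - D\<close> will only be used as first edges, followed by an
    edge with a new color, so any color in \<open>{1..k}\<close> would do for them.\<close>
  define c' where "c' e = (if e \<subseteq> D then c e else if e \<inter> D = {} then 1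
    else if \<exists>v\<in>X. e = {v, f v} then k + 1 else k + 2)" for e
  \<comment> \<open>For \<open>v\<close> outside \<open>D\<close> this is the color of
    \<open>{v, f v}\<close>. The value 1 on \<open>D\<close> makes
    \<open>insert (L z) {1..k}\<close> collapse to \<open>{1..k}\<close> for \<open>z\<close> in
    \<open>D\<close>, so that later claims treat all \<open>z\<close> alike.\<close>
  define L where "L v = (if v \<in> D then 1 else if v \<in> X then k + 1 else k + 2)" for v
  have arc: "\<exists>e \<in> arcs G. tail G e = u \<and> head G e = v \<and> edge_of G e = {u, v}"
    if "u \<rightarrow>\<^bsub>G\<^esub> v" for u v
    using that by (auto simp: arcs_ends_conv edge_of_def)
  have cD: "c {u, v} \<in> {1..k}" if uv: "u \<rightarrow>\<^bsub>G\<^esub> v" "u \<in> D" "v \<in> D" for u v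
  proof -
    obtain e where "e \<in> arcs G" "tail G e = u" "head G e = v" using arc[OF uv(1)] by blast
    then have "{u, v} \<in> edges (G \<restriction> D)"
      unfolding edges_def using uv by (intro image_eqI[of _ _ e]) (auto simp: edge_of_def)
    then show ?thesis using c by blast
  qed
  have c'_f: "c' {v, f v} = L v" if "v \<in> verts G - D" for v
  proof -
    \<comment> \<open>Each of these edges has exactly one endpoint outside \<open>D\<close>.\<close>
    have "v = x" if "x \<in> X" "{v, f v} = {x, f x}" for x
      using that X(1) f[of x] \<open>v \<in> verts G - D\<close> unfolding doubleton_eq_iff by blast
    then have "(\<exists>x\<in>X. {v, f v} = {x, f x}) \<longleftrightarrow> v \<in> X" by blast
    then show ?thesis using that f[OF that] by (simp add: c'_def L_def)
  qed
  have c'_X: "c' {v, w} = k + 2" if "v \<in> X" "w \<in> D" "w \<noteq> f v" for v w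
  proof -
    have "{v, w} \<noteq> {x, f x}" if "x \<in> X" for x
      using that X(1) f[of x] \<open>v \<in> X\<close> \<open>w \<in> D\<close> \<open>w \<noteq> f v\<close> unfolding doubleton_eq_iff by blast
    then have "\<not> (\<exists>x\<in>X. {v, w} = {x, f x})" by blast
    moreover have "v \<notin> D" using \<open>v \<in> X\<close> X(1) by blast
    ultimately show ?thesis using \<open>w \<in> D\<close> by (simp add: c'_def)
  qed
  \<comment> \<open>The bounds on the vertices and on the first color are what prepending an edge at
    \<open>w\<close> requires. The first color is \<open>L z\<close> only if the path is the single
    edge from \<open>f z\<close> to \<open>z\<close>.\<close>
  have to_vertex: "\<exists>p. proper_path G c' w p z \<and> set (awalk_verts w p) \<subseteq> insert z D \<and>
      (p \<noteq> [] \<longrightarrow> c' (edge_of G (hd p)) \<in> insert (L z) {1..k})"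
    if wz: "w \<in> D" "z \<in> verts G" for w z
  proof -
    \<comment> \<open>All edges are controlled, not only the first: the last one is going to meet
      the new color of \<open>{f z, z}\<close>.\<close>
    have inner: "\<exists>p. proper_path G c' w p z \<and> set (awalk_verts w p) \<subseteq> D \<and>
      (\<forall>e\<in>set p. c' (edge_of G e) \<in> {1..k})" if zD: "z \<in> D" for z
    proof (cases "w = z")
      case True
      then show ?thesis using wz DV
        by (intro exI[of _ "[]"]) (auto simp: proper_path_def apath_Nil_iff)
    next
      case False
      then obtain p where p: "proper_path (G \<restriction> D) c w p z"
        using cp wz zD by (auto simp: proper_path_coloring_def)
      then have ap: "H.apath w p z" by (simp add: proper_path_def)
      then have arcs: "set p \<subseteq> arcs (G \<restriction> D)" by (auto simp: H.apath_def H.awalk_def)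
      have "apath w p z"
        using ap subgraph_induce_subgraphI[OF DV] by (rule subgraph_apath_imp_apath)
      moreover have eq: "edge_of (G \<restriction> D) = edge_of G" by (auto simp: edge_of_def)
      moreover have c'c: "c' (edge_of G e) = c (edge_of G e)" if "e \<in> set p" for e
        using arcs that by (auto simp: c'_def edge_of_def)
      ultimately have "proper_path G c' w p z"
        using p by (auto simp: proper_path_def cong: successively_cong)
      moreover have "set (awalk_verts w p) \<subseteq> D"
        using \<open>apath w p z\<close> arcs wz by (auto simp: apath_def set_awalk_verts)
      moreover have "c' (edge_of G e) \<in> {1..k}" if "e \<in> set p" for e
        unfolding c'c[OF that] using c arcs that by (force simp: edges_def eq)
      ultimately show ?thesis by blast
    qed
    show ?thesis
    proof (cases "z \<in> D")
      case True
      then show ?thesis using inner[OF True]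
        by (metis hd_in_set insert_absorb insert_iff)
    next
      case False
      then have z: "z \<in> verts G - D" using wz by simp
      then obtain p where p: "proper_path G c' w p (f z)" "set (awalk_verts w p) \<subseteq> D"
        "\<forall>e\<in>set p. c' (edge_of G e) \<in> {1..k}"
        using inner f by blast
      obtain e where e: "e \<in> arcs G" "tail G e = f z" "head G e = z" "edge_of G e = {z, f z}"
        using arc[of "f z" z] adj_sym f[OF z] by (auto simp: insert_commute)
      have Lz: "c' (edge_of G e) = L z" "L z \<notin> {1..k}"
        using c'_f[OF z] e False by (auto simp: L_def)
      have "c' (edge_of G (last p)) \<noteq> c' (edge_of G e)" if "p \<noteq> []"
        using p(3) Lz last_in_set[OF that] by metis
      then have "proper_path G c' w (p @ [e]) z"
        using p(2) False by (intro proper_path_snoc[OF p(1) e(1-3)]) auto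
      moreover from this have "set (awalk_verts w (p @ [e])) \<subseteq> insert z D"
        using p(2) e(3) awalk_verts_append[of w p "[e]" z] by (auto simp: proper_path_def apath_def)
      moreover have "c' (edge_of G (hd (p @ [e]))) \<in> insert (L z) {1..k}"
        using p(3) Lz by (cases p) auto
      ultimately show ?thesis by blast
    qed
  qed
  \<comment> \<open>The color of \<open>{u, w}\<close> has to avoid every color with which the path
    from \<open>w\<close> may start. The vertex bound and the first color are recorded so that one
    more edge can be prepended.\<close>
  have via: "\<exists>p. proper_path G c' u p z \<and> set (awalk_verts u p) \<subseteq> insert u (insert z D) \<and>
      p \<noteq> [] \<and> c' (edge_of G (hd p)) = c' {u, w}"
    if uz: "u \<in> verts G - D" "z \<in> verts G" "u \<noteq> z" and w: "w \<in> D" "u \<rightarrow>\<^bsub>G\<^esub> w"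
      and col: "c' {u, w} \<notin> insert (L z) {1..k}" for u w z
  proof -
    obtain p where p: "proper_path G c' w p z" "set (awalk_verts w p) \<subseteq> insert z D"
      "p \<noteq> [] \<longrightarrow> c' (edge_of G (hd p)) \<in> insert (L z) {1..k}"
      using to_vertex w uz by blast
    obtain e where e: "e \<in> arcs G" "tail G e = u" "head G e = w" "edge_of G e = {u, w}"
      using arc w by blast
    have "proper_path G c' u (e # p) z"
      using p e uz col by (intro proper_path_Cons[OF p(1)]) auto
    moreover from this have "set (awalk_verts u (e # p)) \<subseteq> insert u (insert z D)"
      using p e by auto
    ultimately show ?thesis using e by (intro exI[of _ "e # p"]) auto
  qed
  have Lout: "L v \<notin> {1..k}" if "v \<notin> D" for v using that by (simp add: L_def)
  have from_outside: "\<exists>p. proper_path G c' u p z"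
    if uz: "u \<in> verts G - D" "z \<in> verts G" "u \<noteq> z" for u z
  proof (cases "L u = L z")
    \<comment> \<open>This includes \<open>z\<close> in \<open>D\<close>, where
      \<open>L z = 1\<close> while \<open>L u\<close> exceeds \<open>k\<close>.\<close>
    case False
    then show ?thesis
      using via[OF uz, of "f u"] f[OF uz(1)] c'_f[OF uz(1)] Lout[of u] uz(1) by auto
  next
    case True
    have "(\<exists>x \<in> verts G - D. u \<rightarrow>\<^bsub>G\<^esub> x \<and> L x \<noteq> L u) \<or>
        (\<exists>w \<in> D. u \<rightarrow>\<^bsub>G\<^esub> w \<and> c' {u, w} = k + 2 \<and> L u = k + 1)"
    proof (cases "u \<in> X")
      case False
      then obtain x where "x \<in> X" "u \<rightarrow>\<^bsub>G\<^esub> x" using X(3) uz(1) by blast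
      then show ?thesis using X(1) False uz(1) by (auto simp: L_def)
    next
      case uX: True
      \<comment> \<open>This is where domination being two-way enters. The further neighbor
        \<open>x\<close> gives the second alternative if it lies in \<open>D\<close>; otherwise
        independence of \<open>X\<close> gives \<open>L x = k + 2\<close>.\<close>
      have "\<not> pendant G u" using pend uz(1) by blast
      then obtain x where x: "u \<rightarrow>\<^bsub>G\<^esub> x" "x \<noteq> f u"
        using non_pendant_other_neighbor f[OF uz(1)] by blast
      show ?thesis
      proof (cases "x \<in> D")
        case True
        then show ?thesis using x uX uz(1) c'_X by (auto simp: L_def)
      next
        case False
        moreover have "x \<notin> X" using x uX X(2) by blast
        moreover have "x \<in> verts G" using x(1) by (rule adj_in_verts)
        ultimately show ?thesis using x uX uz(1) by (auto simp: L_def)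
      qed
    qed
    then show ?thesis
    proof (elim disjE bexE conjE)
      fix x assume x: "x \<in> verts G - D" "u \<rightarrow>\<^bsub>G\<^esub> x" "L x \<noteq> L u"
      \<comment> \<open>As \<open>L x\<close> differs from \<open>L u = L z\<close>,
        \<open>via\<close> applies to \<open>x\<close> and \<open>f x\<close>. Its path stays within
        \<open>x\<close>, \<open>z\<close> and \<open>D\<close>, so it misses
        \<open>u\<close>.\<close>
      then have "x \<noteq> z" using True by auto
      moreover have "x \<noteq> u" using x by auto
      ultimately obtain p where p: "proper_path G c' x p z"
        "set (awalk_verts x p) \<subseteq> insert x (insert z D)" "p \<noteq> []"
        "c' (edge_of G (hd p)) = L x"
        using via[OF x(1) uz(2), of "f x"] f[OF x(1)] c'_f[OF x(1)] Lout[of x] x True by auto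
      obtain e where e: "e \<in> arcs G" "tail G e = u" "head G e = x" "edge_of G e = {u, x}"
        using arc x by blast
      have "c' (edge_of G e) = 1" using e x uz(1) by (auto simp: c'_def)
      moreover have "L x \<noteq> 1" using Lout[of x] x k1 by auto
      ultimately have "proper_path G c' u (e # p) z"
        using p e uz \<open>x \<noteq> u\<close> by (intro proper_path_Cons[OF p(1)]) auto
      then show ?thesis by blast
    next
      fix w assume "w \<in> D" "u \<rightarrow>\<^bsub>G\<^esub> w" "c' {u, w} = k + 2" "L u = k + 1"
      then show ?thesis using via[OF uz, of w] True by auto
    qed
  qed
  have "proper_path_coloring G c'"
    unfolding proper_path_coloring_def using from_outside to_vertex by blast
  moreover have "c' ` edges G \<subseteq> {1..k + 2}"
  proof -
    have "c' {u, v} \<in> {1..k + 2}" if "u \<rightarrow>\<^bsub>G\<^esub> v" for u v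
    proof (cases "{u, v} \<subseteq> D")
      case True
      then show ?thesis using cD[OF that] by (fastforce simp: c'_def)
    next
      case False
      then show ?thesis unfolding c'_def by (simp del: insert_subset)
    qed
    then show ?thesis
      by (auto simp: edges_def edge_of_def arcs_ends_conv simp del: atLeastAtMost_iff)
  qed
  ultimately have "pc G \<le> k + 2" by (intro pc_le) auto
  then show ?thesis by (simp add: k_def)
qed

end
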